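(* Let $X$ be a set, $H$ a complex Hilbert space, $\mathfrak{A}$ a unital $C^{*}$-algebra, and let $K,L\in\mathcal{M}$, with canonical factorizations $$K(s,t)(a)=V_{K}(s)^{*}\pi_{K}(a)V_{K}(t),\qquad L(s,t)(a)=V_{L}(s)^{*}\pi_{L}(a)V_{L}(t)\qquad (s,t\in X,\ a\in\mathfrak{A})$$ on the reproducing kernel Hilbert spaces $H_{\tilde{K}}$ and $H_{\tilde{L}}$, respectively. Then $K\leq L$ if and only if there is a positive operator $A\colon H_{\tilde{L}}\to H_{\tilde{L}}$ with $0\leq A\leq I_{H_{\tilde{L}}}$ such that $A\in\pi_{L}(\mathfrak{A})'$ and $$K(s,t)(a)=V_{L}(s)^{*}\pi_{L}(a)AV_{L}(t)\qquad\text{for all } s,t\in X,\ a\in\mathfrak{A}.$$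
   Context: Inner products are linear in the second variable. $\mathcal{B}(H)$ denotes the bounded linear operators on $H$, and $\mathcal{B}(\mathfrak{A},\mathcal{B}(H))$ the bounded linear maps from $\mathfrak{A}$ to $\mathcal{B}(H)$. $1_{\mathfrak{A}}$ is the unit of $\mathfrak{A}$. $\mathcal{M}$ is the class of generalized positive definite kernels, i.e. functions $K\colon X\times X\to \mathcal{B}(\mathfrak{A},\mathcal{B}(H))$ such that $$\sum_{i,j=1}^{N}\left\langle u_{i},K(s_{i},s_{j})(a_{i}^{*}a_{j})u_{j}\right\rangle _{H}\geq 0$$ for all $N\in\mathbb{N}$, $(u_i)_{i=1}^N\subset H$, $(s_i)_{i=1}^N\subset X$, $(a_i)_{i=1}^N\subset\mathfrak{A}$. For $K,L\in\mathcal{M}$, $K\leq L$ means $L-K\in\mathcal{M}$. For $K\in\mathcal{M}$ put $\Omega=X\times\mathfrak{A}\times H$ and define the scalar-valued positive definite kernel $\tilde{K}\colon\Omega\times\Omega\to\mathbb{C}$ by $\tilde{K}((s,a,u),(t,b,v))=\langle u,K(s,t)(a^{*}b)v\rangle_{H}$. $H_{\tilde{K}}$ is its reproducing kernel Hilbert space, the closed linear span of the functions $\tilde{K}_{(t,b,v)}=\tilde{K}(\cdot,(t,b,v))$, with $\langle\tilde{K}_{x},\tilde{K}_{y}\rangle_{H_{\tilde{K}}}=\tilde{K}(x,y)$. The canonical factorization of $K$ is given by the bounded operators $V_{K}(t)\colon H\to H_{\tilde{K}}$, $V_{K}(t)v=\tilde{K}_{(t,1_{\mathfrak{A}},v)}$,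 and the $*$-representation $\pi_{K}\colon\mathfrak{A}\to \mathcal{B}(H_{\tilde{K}})$ determined by $\pi_{K}(a)\tilde{K}_{(t,b,v)}=\tilde{K}_{(t,ab,v)}$; it satisfies $K(s,t)(a)=V_{K}(s)^{*}\pi_{K}(a)V_{K}(t)$. The same definitions apply with $L$ in place of $K$. $\pi_{L}(\mathfrak{A})'$ denotes the commutant of $\pi_{L}(\mathfrak{A})$ in $\mathcal{B}(H_{\tilde{L}})$. *)

theory Defs
  imports
    "HOL-Analysis.Analysis"
    "HOL-Library.Complex_Order"
    "HOL-Library.Function_Algebras"
begin

(* The distribution provides scalar multiplication by reals only. With Function_Algebras
   supplying the pointwise group structure, the instance for functions below makes spaces of
   complex-valued functions subspaces of a complex vector space. *)

class complex_vector = ab_group_add +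
  fixes scaleC :: "complex \<Rightarrow> 'a \<Rightarrow> 'a" (infixr "*\<^sub>C" 75)
  assumes scaleC_add_right: "c *\<^sub>C (x + y) = c *\<^sub>C x + c *\<^sub>C y"
    and scaleC_add_left: "(c + d) *\<^sub>C x = c *\<^sub>C x + d *\<^sub>C x"
    and scaleC_scaleC: "c *\<^sub>C (d *\<^sub>C x) = (c * d) *\<^sub>C x"
    and scaleC_one: "1 *\<^sub>C x = x"

interpretation complex_vector: vector_space "scaleC :: complex \<Rightarrow> 'a \<Rightarrow> 'a::complex_vector"
  by unfold_locales (simp_all add: scaleC_add_right scaleC_add_left scaleC_scaleC scaleC_one)

instantiation complex :: complex_vector
begin

definition scaleC_complex :: "complex \<Rightarrow> complex \<Rightarrow> complex"
  where "scaleC_complex c z = c * z"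

instance
  by standard (simp_all add: scaleC_complex_def algebra_simps)

end

instantiation "fun" :: (type, complex_vector) complex_vector
begin

definition scaleC_fun :: "complex \<Rightarrow> ('a \<Rightarrow> 'b) \<Rightarrow> 'a \<Rightarrow> 'b"
  where "scaleC_fun c f = (\<lambda>x. c *\<^sub>C f x)"

instance
  by standard
    (simp_all add: scaleC_fun_def fun_eq_iff scaleC_add_right scaleC_add_left
      scaleC_scaleC scaleC_one)

end


(* A reproducing kernel Hilbert space depends on a kernel, which is a term, so it cannot be a
   type. Hilbert spaces are therefore given by a carrier in a complex vector space together with
   an inner product. Nothing is required of the inner product, or of operators, off the carrier. *)

record 'v ips =
  vecs :: "'v set"
  ip :: "'v \<Rightarrow> 'v \<Rightarrow> complex"

definition hnorm :: "'v ips \<Rightarrow> 'v \<Rightarrow> real"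
  where "hnorm H f = sqrt (Re (ip H f f))"

(* The order on complex numbers is that of Complex_Order: 0 <= z means that z is real and
   nonnegative. *)
locale complex_hilbert_space =
  fixes H :: "'v::complex_vector ips"
  assumes subspace: "complex_vector.subspace (vecs H)"
    and ip_add_right: "\<lbrakk>f \<in> vecs H; g \<in> vecs H; h \<in> vecs H\<rbrakk> \<Longrightarrow> ip H f (g + h) = ip H f g + ip H f h"
    and ip_scale_right: "\<lbrakk>f \<in> vecs H; g \<in> vecs H\<rbrakk> \<Longrightarrow> ip H f (c *\<^sub>C g) = c * ip H f g"
    and ip_commute: "\<lbrakk>f \<in> vecs H; g \<in> vecs H\<rbrakk> \<Longrightarrow> ip H g f = cnj (ip H f g)"
    and ip_nonneg: "f \<in> vecs H \<Longrightarrow> 0 \<le> ip H f f"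
    and ip_definite: "\<lbrakk>f \<in> vecs H; ip H f f = 0\<rbrakk> \<Longrightarrow> f = 0"
    and complete: "\<lbrakk>\<forall>n. \<sigma> n \<in> vecs H; \<forall>\<epsilon>>0. \<exists>M. \<forall>m\<ge>M. \<forall>n\<ge>M. hnorm H (\<sigma> m - \<sigma> n) < \<epsilon>\<rbrakk>
      \<Longrightarrow> \<exists>f\<in>vecs H. (\<lambda>n. hnorm H (\<sigma> n - f)) \<longlonglongrightarrow> 0"

class complex_normed_vector = complex_vector + real_normed_vector +
  assumes scaleR_scaleC: "r *\<^sub>R x = complex_of_real r *\<^sub>C x"
    and norm_scaleC: "norm (c *\<^sub>C x) = cmod c * norm x"

class chilbert = complex_normed_vector + complete_space +
  fixes cinner :: "'a \<Rightarrow> 'a \<Rightarrow> complex"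
  assumes cinner_add_right: "cinner x (y + z) = cinner x y + cinner x z"
    and cinner_scaleC_right: "cinner x (c *\<^sub>C y) = c * cinner x y"
    and cinner_commute: "cinner y x = cnj (cinner x y)"
    and cinner_nonneg: "0 \<le> cinner x x"
    and norm_eq_sqrt_cinner: "norm x = sqrt (Re (cinner x x))"

abbreviation whole_space :: "'h::chilbert ips"
  where "whole_space \<equiv> \<lparr>vecs = UNIV, ip = cinner\<rparr>"

lemma hnorm_whole_space: "hnorm whole_space x = norm x"
  by (simp add: hnorm_def norm_eq_sqrt_cinner)

lemma complex_hilbert_space_whole_space: "complex_hilbert_space (whole_space :: 'h::chilbert ips)"
proof
  fix f :: 'h
  assume "ip whole_space f f = 0"
  then have "norm f = 0"
    by (simp add: norm_eq_sqrt_cinner)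
  then show "f = 0"
    by simp
next
  fix \<sigma> :: "nat \<Rightarrow> 'h"
  assume "\<forall>\<epsilon>>0. \<exists>M. \<forall>m\<ge>M. \<forall>n\<ge>M. hnorm whole_space (\<sigma> m - \<sigma> n) < \<epsilon>"
  then have "Cauchy \<sigma>"
    by (simp add: hnorm_whole_space Cauchy_def dist_norm)
  then obtain f where "\<sigma> \<longlonglongrightarrow> f"
    using Cauchy_convergent convergent_def by blast
  then have "(\<lambda>n. norm (\<sigma> n - f)) \<longlonglongrightarrow> 0"
    by (simp add: LIM_zero_iff tendsto_norm_zero_iff)
  then show "\<exists>f\<in>vecs whole_space. (\<lambda>n. hnorm whole_space (\<sigma> n - f)) \<longlonglongrightarrow> 0"
    by (auto simp add: hnorm_whole_space)
qed (use cinner_commute in \<open>auto simp: cinner_add_right cinner_scaleC_right cinner_nonneg\<close>)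

definition bounded_ops ::
    "'v::complex_vector ips \<Rightarrow> 'w::complex_vector ips \<Rightarrow> ('v \<Rightarrow> 'w) set"
  where "bounded_ops H G = {T.
    (\<forall>f\<in>vecs H. T f \<in> vecs G) \<and>
    (\<forall>f\<in>vecs H. \<forall>g\<in>vecs H. T (f + g) = T f + T g) \<and>
    (\<forall>c. \<forall>f\<in>vecs H. T (c *\<^sub>C f) = c *\<^sub>C T f) \<and>
    (\<exists>C. \<forall>f\<in>vecs H. hnorm G (T f) \<le> C * hnorm H f)}"

definition adjoint_op :: "'v ips \<Rightarrow> 'w ips \<Rightarrow> ('v \<Rightarrow> 'w) \<Rightarrow> 'w \<Rightarrow> 'v"
  where "adjoint_op H G T g = (THE f. f \<in> vecs H \<and> (\<forall>h\<in>vecs H. ip H h f = ip G (T h) g))"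

definition positive_op :: "'v::complex_vector ips \<Rightarrow> ('v \<Rightarrow> 'v) \<Rightarrow> bool"
  where "positive_op H T \<longleftrightarrow> T \<in> bounded_ops H H \<and> (\<forall>f\<in>vecs H. 0 \<le> ip H f (T f))"

definition op_le :: "'v::complex_vector ips \<Rightarrow> ('v \<Rightarrow> 'v) \<Rightarrow> ('v \<Rightarrow> 'v) \<Rightarrow> bool"
  where "op_le H S T \<longleftrightarrow> positive_op H (\<lambda>f. T f - S f)"

definition commutant :: "'v::complex_vector ips \<Rightarrow> ('v \<Rightarrow> 'v) set \<Rightarrow> ('v \<Rightarrow> 'v) set"
  where "commutant H \<B> = {T \<in> bounded_ops H H. \<forall>S\<in>\<B>. \<forall>f\<in>vecs H. T (S f) = S (T f)}"


(* Unital C*-algebras. The sort monoid_mult supplies the unit without imposing 1 \<noteq> 0,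
   so the zero algebra is not excluded. *)
class cstar_algebra = complex_normed_vector + real_normed_algebra + complete_space + monoid_mult +
  fixes star :: "'a \<Rightarrow> 'a"
  assumes mult_scaleC_left: "(c *\<^sub>C x) * y = c *\<^sub>C (x * y)"
    and mult_scaleC_right: "x * (c *\<^sub>C y) = c *\<^sub>C (x * y)"
    and star_star: "star (star x) = x"
    and star_add: "star (x + y) = star x + star y"
    and star_scaleC: "star (c *\<^sub>C x) = cnj c *\<^sub>C star x"
    and star_mult: "star (x * y) = star y * star x"
    and cstar_identity: "norm (star x * x) = (norm x)\<^sup>2"

lemma star_one: "star (1::'a::cstar_algebra) = 1"
  by (metis mult_1 mult_1_right star_mult star_star)

definition star_representation ::
    "'v::complex_vector ips \<Rightarrow> ('a::cstar_algebra \<Rightarrow> 'v \<Rightarrow> 'v) \<Rightarrow> bool"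
  where "star_representation H \<pi> \<longleftrightarrow>
    (\<forall>a. \<pi> a \<in> bounded_ops H H) \<and>
    (\<forall>a b. \<forall>f\<in>vecs H. \<pi> (a + b) f = \<pi> a f + \<pi> b f) \<and>
    (\<forall>c a. \<forall>f\<in>vecs H. \<pi> (c *\<^sub>C a) f = c *\<^sub>C \<pi> a f) \<and>
    (\<forall>a b. \<forall>f\<in>vecs H. \<pi> (a * b) f = \<pi> a (\<pi> b f)) \<and>
    (\<forall>a. \<forall>f\<in>vecs H. \<forall>g\<in>vecs H. ip H f (\<pi> (star a) g) = ip H (\<pi> a f) g)"


definition bounded_maps_into_ops :: "('a::cstar_algebra \<Rightarrow> 'h::chilbert \<Rightarrow> 'h) set"
  where "bounded_maps_into_ops = {\<Phi>.
    (\<forall>a. \<Phi> a \<in> bounded_ops whole_space whole_space) \<and>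
    (\<forall>a b. \<Phi> (a + b) = \<Phi> a + \<Phi> b) \<and>
    (\<forall>c a. \<Phi> (c *\<^sub>C a) = c *\<^sub>C \<Phi> a) \<and>
    (\<exists>C. \<forall>a u. norm (\<Phi> a u) \<le> C * norm a * norm u)}"

definition gpd_kernels :: "('x \<Rightarrow> 'x \<Rightarrow> 'a::cstar_algebra \<Rightarrow> 'h::chilbert \<Rightarrow> 'h) set"
  where "gpd_kernels = {K.
    (\<forall>s t. K s t \<in> bounded_maps_into_ops) \<and>
    (\<forall>(N::nat) (u :: nat \<Rightarrow> 'h) (s :: nat \<Rightarrow> 'x) (a :: nat \<Rightarrow> 'a).
      0 \<le> (\<Sum>i<N. \<Sum>j<N. cinner (u i) (K (s i) (s j) (star (a i) * a j) (u j))))}"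

definition kernel_le ::
    "('x \<Rightarrow> 'x \<Rightarrow> 'a::cstar_algebra \<Rightarrow> 'h::chilbert \<Rightarrow> 'h) \<Rightarrow> ('x \<Rightarrow> 'x \<Rightarrow> 'a \<Rightarrow> 'h \<Rightarrow> 'h) \<Rightarrow> bool"
  where "kernel_le K L \<longleftrightarrow> L - K \<in> gpd_kernels"

definition scalar_kernel ::
    "('x \<Rightarrow> 'x \<Rightarrow> 'a::cstar_algebra \<Rightarrow> 'h::chilbert \<Rightarrow> 'h) \<Rightarrow> 'x \<times> 'a \<times> 'h \<Rightarrow> 'x \<times> 'a \<times> 'h \<Rightarrow> complex"
  where "scalar_kernel K = (\<lambda>(s, a, u) (t, b, v). cinner u (K s t (star a * b) v))"

definition kernel_section :: "('w \<Rightarrow> 'w \<Rightarrow> complex) \<Rightarrow> 'w \<Rightarrow> 'w \<Rightarrow> complex"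
  where "kernel_section k y = (\<lambda>x. k x y)"

locale rkhs = complex_hilbert_space R for k :: "'w \<Rightarrow> 'w \<Rightarrow> complex" and R :: "('w \<Rightarrow> complex) ips" +
  assumes section_mem: "kernel_section k y \<in> vecs R"
    and reproducing: "f \<in> vecs R \<Longrightarrow> ip R (kernel_section k x) f = f x"
    and dense_span: "\<lbrakk>f \<in> vecs R; 0 < \<epsilon>\<rbrakk> \<Longrightarrow>
      \<exists>g\<in>complex_vector.span (range (kernel_section k)). hnorm R (f - g) < \<epsilon>"

lemma (in rkhs) ip_sections: "ip R (kernel_section k x) (kernel_section k y) = k x y"
  by (simp add: reproducing[OF section_mem]) (simp add: kernel_section_def)

(* These conditions determine the carrier of R, its inner product there, V, and \<pi> on the carrier.
   The factorization of K itself is not assumed; it follows, see factorization below. *)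
locale canonical_factorization =
  rkhs "scalar_kernel K" R
  for K :: "'x \<Rightarrow> 'x \<Rightarrow> 'a::cstar_algebra \<Rightarrow> 'h::chilbert \<Rightarrow> 'h"
    and R :: "('x \<times> 'a \<times> 'h \<Rightarrow> complex) ips" +
  fixes V :: "'x \<Rightarrow> 'h \<Rightarrow> ('x \<times> 'a \<times> 'h \<Rightarrow> complex)"
    and \<pi> :: "'a \<Rightarrow> ('x \<times> 'a \<times> 'h \<Rightarrow> complex) \<Rightarrow> ('x \<times> 'a \<times> 'h \<Rightarrow> complex)"
  assumes V_eq: "V t v = kernel_section (scalar_kernel K) (t, 1, v)"
    and rep: "star_representation R \<pi>"
    and rep_section: "\<pi> a (kernel_section (scalar_kernel K) (t, b, v))
      = kernel_section (scalar_kernel K) (t, a * b, v)"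

lemma (in canonical_factorization) factorization:
  "K s t a = adjoint_op whole_space R (V s) \<circ> \<pi> a \<circ> V t"
proof
  fix v
  interpret W: complex_hilbert_space "whole_space :: 'h ips"
    by (rule complex_hilbert_space_whole_space)
  have eq: "ip R (V s h) (kernel_section (scalar_kernel K) (t, a, v)) = cinner h (K s t a v)" for h
    by (simp add: V_eq ip_sections) (simp add: scalar_kernel_def star_one)
  have "adjoint_op whole_space R (V s) (kernel_section (scalar_kernel K) (t, a, v)) = K s t a v"
    unfolding adjoint_op_def eq
  proof (rule the_equality)
    fix f :: 'h
    assume "f \<in> vecs whole_space \<and> (\<forall>h\<in>vecs whole_space. ip whole_space h f = cinner h (K s t a v))"
    then have f: "cinner h f = cinner h (K s t a v)" for h
      by simp
    have "cinner h ((f - K s t a v) + K s t a v) = cinner h (f - K s t a v) + cinner h (K s t a v)" for h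
      using W.ip_add_right[of h "f - K s t a v" "K s t a v"] by simp
    then have "cinner h (f - K s t a v) = 0" for h
      using f[of h] by simp
    then show "f = K s t a v"
      using W.ip_definite[of "f - K s t a v"] by simp
  qed simp
  then show "K s t a v = (adjoint_op whole_space R (V s) \<circ> \<pi> a \<circ> V t) v"
    by (simp add: V_eq rep_section)
qed

end

theory Submission
  imports Defs
begin

text \<open>If \<open>K \<le> L\<close>, then the map taking each section \<open>L\<^sub>x\<close> to \<open>K\<^sub>x\<close> extends to a contraction between the
  reproducing kernel Hilbert spaces. Its adjoint is a contractive inclusion of \<open>H\<^sub>K\<close> into \<open>H\<^sub>L\<close>, and the
  operator \<open>A\<close> is the inclusion composed with its adjoint: \<open>(A f) x = \<langle>K\<^sub>x, f\<rangle>\<close>, the inner product being that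
  of \<open>H\<^sub>L\<close>. Since \<open>\<pi>(a)\<close> acts on functions by \<open>(\<pi>(a) f)(t, b, v) = f(t, a\<^sup>* b, v)\<close>, it treats the
  sections of \<open>K\<close> like those of \<open>L\<close>, so \<open>A\<close> commutes with it. Conversely, the factorization of \<open>K\<close>
  through \<open>A\<close> says that \<open>\<langle>L\<^sub>x, A L\<^sub>y\<rangle> = K x y\<close>, and \<open>A \<le> I\<close> makes \<open>L - K\<close> positive definite.\<close>

section \<open>Hilbert spaces given by a carrier\<close>

context complex_hilbert_space
begin

lemma zero_mem [simp]: "0 \<in> vecs H"
  by (rule complex_vector.subspace_0[OF subspace])

lemma add_mem [simp]: "f \<in> vecs H \<Longrightarrow> g \<in> vecs H \<Longrightarrow> f + g \<in> vecs H"
  by (rule complex_vector.subspace_add[OF subspace])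

lemma diff_mem [simp]: "f \<in> vecs H \<Longrightarrow> g \<in> vecs H \<Longrightarrow> f - g \<in> vecs H"
  by (rule complex_vector.subspace_diff[OF subspace])

lemma scale_mem [simp]: "f \<in> vecs H \<Longrightarrow> c *\<^sub>C f \<in> vecs H"
  by (rule complex_vector.subspace_scale[OF subspace])

lemma sum_list_mem: "(\<And>x. f x \<in> vecs H) \<Longrightarrow> (\<Sum>x\<leftarrow>xs. f x) \<in> vecs H"
  by (induction xs) auto

lemma ip_diff_right:
  assumes "f \<in> vecs H" "g \<in> vecs H" "h \<in> vecs H"
  shows "ip H f (g - h) = ip H f g - ip H f h"
  using ip_add_right[of f "g - h" h] assms by simp

lemma ip_zero_right [simp]: "f \<in> vecs H \<Longrightarrow> ip H f 0 = 0"
  using ip_diff_right[of f 0 0] by simp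

lemma ip_add_left:
  assumes "f \<in> vecs H" "g \<in> vecs H" "h \<in> vecs H"
  shows "ip H (f + g) h = ip H f h + ip H g h"
  using ip_commute[of h "f + g"] ip_commute[of h f] ip_commute[of h g] assms
  by (simp add: ip_add_right)

lemma ip_diff_left:
  assumes "f \<in> vecs H" "g \<in> vecs H" "h \<in> vecs H"
  shows "ip H (f - g) h = ip H f h - ip H g h"
  using ip_add_left[of "f - g" g h] assms by simp

lemma ip_zero_left [simp]: "f \<in> vecs H \<Longrightarrow> ip H 0 f = 0"
  using ip_diff_left[of 0 0 f] by simp

lemma ip_scale_left:
  assumes "f \<in> vecs H" "g \<in> vecs H"
  shows "ip H (c *\<^sub>C f) g = cnj c * ip H f g"
  using ip_commute[of g "c *\<^sub>C f"] ip_commute[of g f] assms by (simp add: ip_scale_right)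

lemma ip_sum_list_right:
  assumes "h \<in> vecs H" "\<And>x. f x \<in> vecs H"
  shows "ip H h (\<Sum>x\<leftarrow>xs. f x) = (\<Sum>x\<leftarrow>xs. ip H h (f x))"
  by (induction xs) (simp_all add: assms ip_add_right sum_list_mem)

lemma ip_sum_list_left:
  assumes "h \<in> vecs H" "\<And>x. f x \<in> vecs H"
  shows "ip H (\<Sum>x\<leftarrow>xs. f x) h = (\<Sum>x\<leftarrow>xs. ip H (f x) h)"
  by (induction xs) (simp_all add: assms ip_add_left sum_list_mem)

lemma hnorm_nonneg [simp]: "f \<in> vecs H \<Longrightarrow> 0 \<le> hnorm H f"
  using ip_nonneg[of f] by (simp add: hnorm_def less_eq_complex_def)

lemma hnorm_sq: "f \<in> vecs H \<Longrightarrow> (hnorm H f)\<^sup>2 = Re (ip H f f)"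
  using ip_nonneg[of f] by (simp add: hnorm_def less_eq_complex_def)

lemma ip_self: "f \<in> vecs H \<Longrightarrow> ip H f f = complex_of_real ((hnorm H f)\<^sup>2)"
  using ip_nonneg[of f] by (simp add: hnorm_sq less_eq_complex_def complex_eq_iff)

lemma Re_ip_commute: "f \<in> vecs H \<Longrightarrow> g \<in> vecs H \<Longrightarrow> Re (ip H g f) = Re (ip H f g)"
  using ip_commute[of f g] by simp

lemma hnorm_add_sq:
  assumes "f \<in> vecs H" "g \<in> vecs H"
  shows "(hnorm H (f + g))\<^sup>2 = (hnorm H f)\<^sup>2 + 2 * Re (ip H f g) + (hnorm H g)\<^sup>2"
  using assms by (simp add: hnorm_sq ip_add_left ip_add_right Re_ip_commute)

lemma hnorm_diff_sq:
  assumes "f \<in> vecs H" "g \<in> vecs H"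
  shows "(hnorm H (f - g))\<^sup>2 = (hnorm H f)\<^sup>2 - 2 * Re (ip H f g) + (hnorm H g)\<^sup>2"
  using assms by (simp add: hnorm_sq ip_diff_left ip_diff_right Re_ip_commute)

lemma hnorm_scale: "f \<in> vecs H \<Longrightarrow> hnorm H (c *\<^sub>C f) = cmod c * hnorm H f"
proof -
  assume f: "f \<in> vecs H"
  have "ip H (c *\<^sub>C f) (c *\<^sub>C f) = (cnj c * c) * ip H f f"
    using f by (simp add: ip_scale_left ip_scale_right)
  also have "\<dots> = complex_of_real ((cmod c)\<^sup>2 * (hnorm H f)\<^sup>2)"
    using f by (simp add: ip_self complex_norm_square[symmetric] mult.commute[of "cnj c"] del: of_real_power)
  finally have "(hnorm H (c *\<^sub>C f))\<^sup>2 = (cmod c * hnorm H f)\<^sup>2"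
    using f by (simp add: hnorm_sq[of "c *\<^sub>C f"] power_mult_distrib)
  then show ?thesis
    by (rule power2_eq_imp_eq) (simp_all add: f)
qed

lemma hnorm_eq_zero: "f \<in> vecs H \<Longrightarrow> hnorm H f = 0 \<Longrightarrow> f = 0"
  by (rule ip_definite) (simp_all add: ip_self)

lemma hnorm_add_scale_sq:
  assumes "f \<in> vecs H" "g \<in> vecs H"
  shows "(hnorm H (f + c *\<^sub>C g))\<^sup>2 = (hnorm H f)\<^sup>2 + 2 * Re (c * ip H f g) + (cmod c)\<^sup>2 * (hnorm H g)\<^sup>2"
  using assms by (simp add: hnorm_add_sq ip_scale_right hnorm_scale power_mult_distrib)

text \<open>The squared norm of \<open>f + c *\<^sub>C g\<close> is nonnegative for every scalar
  \<open>c\<close>; the optimal \<open>c\<close> gives the bound.\<close>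

lemma Cauchy_Schwarz:
  assumes f: "f \<in> vecs H" and g: "g \<in> vecs H"
  shows "cmod (ip H f g) \<le> hnorm H f * hnorm H g"
proof (cases "hnorm H g = 0")
  case True
  then show ?thesis
    using hnorm_eq_zero[OF g] f by simp
next
  case False
  define r where "r = (hnorm H g)\<^sup>2"
  have r: "r > 0"
    using False by (simp add: r_def)
  \<comment> \<open>This scalar minimises the norm of \<open>f + c *\<^sub>C g\<close>; the vector
    obtained is the component of \<open>f\<close> orthogonal to \<open>g\<close>.\<close>
  define c where "c = - cnj (ip H f g) / complex_of_real r"
  have 1: "Re (c * ip H f g) = - (cmod (ip H f g))\<^sup>2 / r"
    by (simp add: c_def mult.commute[of "cnj _"] complex_norm_square[symmetric] flip: of_real_power)
  have 2: "(cmod c)\<^sup>2 * r = (cmod (ip H f g))\<^sup>2 / r"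
    using r by (simp add: c_def norm_divide power_divide power2_eq_square)
  have "0 \<le> (hnorm H (f + c *\<^sub>C g))\<^sup>2"
    by simp
  also have "\<dots> = (hnorm H f)\<^sup>2 - (cmod (ip H f g))\<^sup>2 / r"
    using 1 2 f g by (simp add: hnorm_add_scale_sq r_def)
  finally have "(cmod (ip H f g))\<^sup>2 \<le> (hnorm H f * hnorm H g)\<^sup>2"
    using r by (simp add: field_simps r_def)
  then show ?thesis
    by (rule power2_le_imp_le) (simp add: f g)
qed

lemma ip_tendsto_right:
  assumes "\<And>n. \<sigma> n \<in> vecs H" "f \<in> vecs H" "g \<in> vecs H"
    and "(\<lambda>n. hnorm H (\<sigma> n - f)) \<longlonglongrightarrow> 0"
  shows "(\<lambda>n. ip H g (\<sigma> n)) \<longlonglongrightarrow> ip H g f"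
proof -
  have lim: "(\<lambda>n. hnorm H g * hnorm H (\<sigma> n - f)) \<longlonglongrightarrow> 0"
    using tendsto_mult_right_zero[OF assms(4)] .
  have "cmod (ip H g (\<sigma> n) - ip H g f) \<le> hnorm H g * hnorm H (\<sigma> n - f)" for n
    using Cauchy_Schwarz[of g "\<sigma> n - f"] assms by (simp add: ip_diff_right)
  then have "(\<lambda>n. ip H g (\<sigma> n) - ip H g f) \<longlonglongrightarrow> 0"
    by (intro Lim_null_comparison[OF always_eventually lim]) blast
  then show ?thesis
    by (simp add: LIM_zero_iff)
qed

lemma ip_tendsto_left:
  assumes "\<And>n. \<sigma> n \<in> vecs H" "f \<in> vecs H" "g \<in> vecs H"
    and "(\<lambda>n. hnorm H (\<sigma> n - f)) \<longlonglongrightarrow> 0"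
  shows "(\<lambda>n. ip H (\<sigma> n) g) \<longlonglongrightarrow> ip H f g"
  using tendsto_cnj[OF ip_tendsto_right[OF assms]] assms by (simp add: ip_commute[symmetric])

text \<open>Expanding the squared norm of \<open>\<sigma> n - f\<close> expresses that of
  \<open>\<sigma> n\<close> through quantities whose limits are known.\<close>

lemma hnorm_sq_tendsto:
  assumes "\<And>n. \<sigma> n \<in> vecs H" "f \<in> vecs H"
    and "(\<lambda>n. hnorm H (\<sigma> n - f)) \<longlonglongrightarrow> 0"
  shows "(\<lambda>n. (hnorm H (\<sigma> n))\<^sup>2) \<longlonglongrightarrow> (hnorm H f)\<^sup>2"
proof -
  have "(\<lambda>n. (hnorm H (\<sigma> n - f))\<^sup>2 + 2 * Re (ip H (\<sigma> n) f) - (hnorm H f)\<^sup>2)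
      \<longlonglongrightarrow> 0\<^sup>2 + 2 * Re (ip H f f) - (hnorm H f)\<^sup>2"
    by (intro tendsto_intros ip_tendsto_left assms)
  then show ?thesis
    using assms by (simp add: hnorm_diff_sq hnorm_sq[symmetric])
qed

lemma hnorm_tendsto:
  assumes "\<And>n. \<sigma> n \<in> vecs H" "f \<in> vecs H"
    and "(\<lambda>n. hnorm H (\<sigma> n - f)) \<longlonglongrightarrow> 0"
  shows "(\<lambda>n. hnorm H (\<sigma> n)) \<longlonglongrightarrow> hnorm H f"
  using tendsto_real_sqrt[OF hnorm_sq_tendsto[OF assms]] assms by simp

text \<open>A relation in place of a functional: for sums of kernel sections, single-valuedness need not be
  checked separately, since it is part of the bound.\<close>

lemma Riesz_linear_relation:
  fixes G :: "('v \<times> complex) set"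
  assumes mem: "\<And>f z. (f, z) \<in> G \<Longrightarrow> f \<in> vecs H"
    and zero: "(0, 0) \<in> G"
    and add: "\<And>f z g w. (f, z) \<in> G \<Longrightarrow> (g, w) \<in> G \<Longrightarrow> (f + g, z + w) \<in> G"
    and scale: "\<And>c f z. (f, z) \<in> G \<Longrightarrow> (c *\<^sub>C f, c * z) \<in> G"
    and bound: "\<And>f z. (f, z) \<in> G \<Longrightarrow> cmod z \<le> C * hnorm H f"
  obtains h where "h \<in> vecs H" "\<And>f z. (f, z) \<in> G \<Longrightarrow> ip H h f = z" "hnorm H h \<le> \<bar>C\<bar>"
proof -
  \<comment> \<open>The representing vector minimises this functional, and a minimising sequence is Cauchy
    by the parallelogram law.\<close>
  define Q where "Q = (\<lambda>(f, z). (hnorm H f)\<^sup>2 - 2 * Re z)"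
  have Q_ge: "- C\<^sup>2 \<le> Q p" if "p \<in> G" for p
  proof -
    obtain f z where p: "p = (f, z)"
      by force
    have "Re z \<le> C * hnorm H f"
      using bound[of f z] complex_Re_le_cmod[of z] that p by simp
    moreover have "0 \<le> (hnorm H f - C)\<^sup>2"
      by simp
    ultimately show ?thesis
      by (simp add: p Q_def power2_diff mult.commute)
  qed
  define m where "m = Inf (Q ` G)"
  have bdd: "bdd_below (Q ` G)"
    using Q_ge by (intro bdd_belowI[of _ "- C\<^sup>2"]) blast
  have m_le: "m \<le> Q p" if "p \<in> G" for p
    unfolding m_def using bdd that by (simp add: cINF_lower)
  have "\<exists>p\<in>G. Q p < m + inverse (real (Suc n))" for n
    using cInf_lessD[of "Q ` G" "m + inverse (real (Suc n))"] zero unfolding m_def by (simp add: bex_simps) fast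
  then obtain p where p: "\<And>n. p n \<in> G" "\<And>n. Q (p n) < m + inverse (real (Suc n))"
    by metis
  define \<sigma> where "\<sigma> n = fst (p n)" for n
  define z where "z n = snd (p n)" for n
  have G: "(\<sigma> n, z n) \<in> G" for n
    using p by (simp add: \<sigma>_def z_def)
  have \<sigma>: "\<sigma> n \<in> vecs H" for n
    using mem[OF G] .
  have Q: "(hnorm H (\<sigma> n))\<^sup>2 - 2 * Re (z n) < m + inverse (real (Suc n))" for n
    using p(2)[of n] by (simp add: Q_def \<sigma>_def z_def split_beta)
  have close: "(hnorm H (\<sigma> k - \<sigma> n))\<^sup>2 < 2 * inverse (real (Suc k)) + 2 * inverse (real (Suc n))" for k n
  proof -
    have "m \<le> Q ((1/2) *\<^sub>C (\<sigma> k + \<sigma> n), (1/2) * (z k + z n))"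
      by (intro m_le scale add G)
    then have "4 * m \<le> (hnorm H (\<sigma> k + \<sigma> n))\<^sup>2 - 4 * Re (z k) - 4 * Re (z n)"
      by (simp add: Q_def hnorm_scale \<sigma> power2_eq_square) (simp add: field_simps)
    then show ?thesis
      using Q[of k] Q[of n] by (simp add: hnorm_diff_sq hnorm_add_sq \<sigma>)
  qed
  have "\<exists>f\<in>vecs H. (\<lambda>n. hnorm H (\<sigma> n - f)) \<longlonglongrightarrow> 0"
  proof (rule complete)
    show "\<forall>\<epsilon>>0. \<exists>M. \<forall>k\<ge>M. \<forall>n\<ge>M. hnorm H (\<sigma> k - \<sigma> n) < \<epsilon>"
    proof (intro allI impI)
      fix \<epsilon> :: real
      assume e: "\<epsilon> > 0"
      then obtain M where M: "inverse (real (Suc M)) < \<epsilon>\<^sup>2 / 4"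
        using reals_Archimedean[of "\<epsilon>\<^sup>2 / 4"] by auto
      have "hnorm H (\<sigma> k - \<sigma> n) < \<epsilon>" if "k \<ge> M" "n \<ge> M" for k n
      proof -
        have "inverse (real (Suc j)) \<le> inverse (real (Suc M))" if "j \<ge> M" for j
          using that by (intro le_imp_inverse_le) auto
        from this[of k] this[of n] have "(hnorm H (\<sigma> k - \<sigma> n))\<^sup>2 < \<epsilon>\<^sup>2"
          using close[of k n] M that by linarith
        then show ?thesis
          using e by (simp add: power_less_imp_less_base)
      qed
      then show "\<exists>M. \<forall>k\<ge>M. \<forall>n\<ge>M. hnorm H (\<sigma> k - \<sigma> n) < \<epsilon>"
        by blast
    qed
  qed (simp add: \<sigma>)
  then obtain h where h: "h \<in> vecs H" and lim: "(\<lambda>n. hnorm H (\<sigma> n - h)) \<longlonglongrightarrow> 0"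
    by blast
  have rep: "ip H h g = w" if gw: "(g, w) \<in> G" for g w
  proof -
    have g: "g \<in> vecs H"
      using mem gw .
    \<comment> \<open>Moving from the minimising sequence in the direction \<open>(g, w)\<close>
      cannot bring \<open>Q\<close> below its infimum. The excess of \<open>Q\<close> along the
      sequence is at most \<open>inverse (real (Suc n))\<close> and vanishes in the limit.\<close>
    have pos: "0 \<le> 2 * Re (c * (ip H h g - w)) + (cmod c)\<^sup>2 * (hnorm H g)\<^sup>2" for c
    proof -
      have "0 \<le> 2 * Re (c * (ip H (\<sigma> n) g - w)) + (cmod c)\<^sup>2 * (hnorm H g)\<^sup>2 + inverse (real (Suc n))" for n
      proof -
        have "m \<le> Q (\<sigma> n + c *\<^sub>C g, z n + c * w)"
          by (intro m_le scale add G gw)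
        then show ?thesis
          using Q[of n] by (simp add: Q_def hnorm_add_scale_sq \<sigma> g algebra_simps)
      qed
      moreover have "(\<lambda>n. 2 * Re (c * (ip H (\<sigma> n) g - w)) + (cmod c)\<^sup>2 * (hnorm H g)\<^sup>2 + inverse (real (Suc n)))
          \<longlonglongrightarrow> 2 * Re (c * (ip H h g - w)) + (cmod c)\<^sup>2 * (hnorm H g)\<^sup>2 + 0"
        by (intro tendsto_intros ip_tendsto_left \<sigma> h g lim LIMSEQ_inverse_real_of_nat)
      ultimately have "0 \<le> 2 * Re (c * (ip H h g - w)) + (cmod c)\<^sup>2 * (hnorm H g)\<^sup>2 + 0"
        by (intro LIMSEQ_le_const) blast+
      then show ?thesis
        by simp
    qed
    define d where "d = ip H h g - w"
    \<comment> \<open>Step size for \<open>c = - t * cnj d\<close>: the linear term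
      \<open>- 2 * t * (cmod d)\<^sup>2\<close> then outweighs the quadratic one, which forces
      \<open>d = 0\<close>. Adding 1 covers the case that \<open>g\<close> vanishes.\<close>
    define t where "t = inverse ((hnorm H g)\<^sup>2 + 1)"
    have t: "t > 0" "t * (hnorm H g)\<^sup>2 < 1"
      by (auto simp: t_def add_nonneg_pos divide_simps)
    have "Re (- (of_real t * cnj d) * d) = - t * (cmod d)\<^sup>2"
      unfolding cmod_power2 by (simp add: power2_eq_square algebra_simps)
    then have "0 \<le> (cmod d)\<^sup>2 * t * (t * (hnorm H g)\<^sup>2 - 2)"
      using pos[of "- (of_real t * cnj d)"] t
      by (simp add: d_def[symmetric] norm_mult power_mult_distrib algebra_simps power2_eq_square)
    then have "(cmod d)\<^sup>2 * t = 0"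
      using t by (simp add: zero_le_mult_iff mult_le_0_iff)
    then show ?thesis
      using t by (simp add: d_def)
  qed
  \<comment> \<open>The vector \<open>h\<close> need not occur in \<open>G\<close>, so the bound is
    used along \<open>\<sigma>\<close> and passed to the limit. The absolute value covers a negative
    \<open>C\<close>.\<close>
  have "(hnorm H h)\<^sup>2 \<le> \<bar>C\<bar> * hnorm H h"
  proof (rule LIMSEQ_le)
    show "(\<lambda>n. cmod (ip H h (\<sigma> n))) \<longlonglongrightarrow> (hnorm H h)\<^sup>2"
      using tendsto_norm[OF ip_tendsto_right[OF \<sigma> h h lim]] h by (simp add: ip_self norm_power)
    show "(\<lambda>n. \<bar>C\<bar> * hnorm H (\<sigma> n)) \<longlonglongrightarrow> \<bar>C\<bar> * hnorm H h"
      by (intro tendsto_intros hnorm_tendsto \<sigma> h lim)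
    have "cmod (ip H h (\<sigma> n)) \<le> \<bar>C\<bar> * hnorm H (\<sigma> n)" for n
      using bound[OF G[of n]] rep[OF G[of n]] mult_right_mono[OF abs_ge_self[of C] hnorm_nonneg[OF \<sigma>[of n]]]
      by simp
    then show "\<exists>N. \<forall>n\<ge>N. cmod (ip H h (\<sigma> n)) \<le> \<bar>C\<bar> * hnorm H (\<sigma> n)"
      by blast
  qed
  then have "hnorm H h \<le> \<bar>C\<bar>"
    using h hnorm_nonneg[OF h] by (cases "hnorm H h = 0") (auto simp: power2_eq_square)
  with that h rep show thesis
    by blast
qed

lemma hnorm_triangle_diff:
  assumes "f \<in> vecs H" "g \<in> vecs H"
  shows "hnorm H (f - g) \<le> hnorm H f + hnorm H g"
proof (rule power2_le_imp_le)
  have "- Re (ip H f g) \<le> hnorm H f * hnorm H g"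
    using Cauchy_Schwarz[OF assms] abs_Re_le_cmod[of "ip H f g"] by linarith
  then show "(hnorm H (f - g))\<^sup>2 \<le> (hnorm H f + hnorm H g)\<^sup>2"
    using assms by (simp add: hnorm_diff_sq power2_sum)
qed (simp add: assms)

lemma ip_right_eqI:
  assumes "f \<in> vecs H" "g \<in> vecs H" and eq: "\<And>h. h \<in> vecs H \<Longrightarrow> ip H h f = ip H h g"
  shows "f = g"
proof -
  have "ip H (f - g) (f - g) = 0"
    using assms eq[of "f - g"] by (simp add: ip_diff_right)
  then show ?thesis
    using ip_definite[of "f - g"] assms by simp
qed

text \<open>Split the inner product as that of \<open>\<sigma> n - f\<close> with
  \<open>\<tau> n\<close> plus that of \<open>f\<close> with \<open>\<tau> n\<close>. The first part
  vanishes by Cauchy-Schwarz, since the norms of \<open>\<tau> n\<close> converge.\<close>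

lemma ip_tendsto:
  assumes f: "\<And>n. \<sigma> n \<in> vecs H" "f \<in> vecs H" "(\<lambda>n. hnorm H (\<sigma> n - f)) \<longlonglongrightarrow> 0"
    and g: "\<And>n. \<tau> n \<in> vecs H" "g \<in> vecs H" "(\<lambda>n. hnorm H (\<tau> n - g)) \<longlonglongrightarrow> 0"
  shows "(\<lambda>n. ip H (\<sigma> n) (\<tau> n)) \<longlonglongrightarrow> ip H f g"
proof -
  have lim: "(\<lambda>n. hnorm H (\<sigma> n - f) * hnorm H (\<tau> n)) \<longlonglongrightarrow> 0"
    using tendsto_mult[OF f(3) hnorm_tendsto[OF g]] by simp
  have "(\<lambda>n. ip H (\<sigma> n - f) (\<tau> n)) \<longlonglongrightarrow> 0"
    by (intro Lim_null_comparison[OF always_eventually lim] allI Cauchy_Schwarz diff_mem f g)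
  from tendsto_add[OF this ip_tendsto_right[OF g(1,2) f(2) g(3)]] show ?thesis
    by (simp add: ip_diff_left f g)
qed

end

section \<open>Limits of nonnegative complex numbers, and bounded operators\<close>

lemma LIMSEQ_complex_nonneg:
  fixes z :: complex
  assumes "\<zeta> \<longlonglongrightarrow> z" "\<And>n. 0 \<le> \<zeta> n"
  shows "0 \<le> z"
proof -
  have "0 \<le> Re z"
    using assms(2) by (intro LIMSEQ_le_const[OF tendsto_Re[OF assms(1)]]) (auto simp: less_eq_complex_def)
  moreover have "(\<lambda>n. Im (\<zeta> n)) = (\<lambda>n. 0)"
    using assms(2) by (auto simp: less_eq_complex_def)
  then have "Im z = 0"
    using tendsto_Im[OF assms(1)] LIMSEQ_unique[OF _ tendsto_const] by metis
  ultimately show ?thesis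
    by (simp add: less_eq_complex_def)
qed

lemma bounded_ops_bound:
  assumes "T \<in> bounded_ops H G"
  obtains C where "\<And>f. f \<in> vecs H \<Longrightarrow> hnorm G (T f) \<le> C * hnorm H f"
  using assms unfolding bounded_ops_def by blast

lemma bounded_ops_diff:
  assumes "complex_hilbert_space H" "complex_hilbert_space G"
    and S: "S \<in> bounded_ops H G" and T: "T \<in> bounded_ops H G"
  shows "(\<lambda>f. S f - T f) \<in> bounded_ops H G"
proof -
  interpret H: complex_hilbert_space H by fact
  interpret G: complex_hilbert_space G by fact
  obtain C where C: "\<And>f. f \<in> vecs H \<Longrightarrow> hnorm G (S f) \<le> C * hnorm H f"
    using bounded_ops_bound[OF S] by metis
  obtain D where D: "\<And>f. f \<in> vecs H \<Longrightarrow> hnorm G (T f) \<le> D * hnorm H f"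
    using bounded_ops_bound[OF T] by metis
  have mem: "S f \<in> vecs G" "T f \<in> vecs G" if "f \<in> vecs H" for f
    using S T that by (auto simp: bounded_ops_def)
  have "hnorm G (S f - T f) \<le> (C + D) * hnorm H f" if "f \<in> vecs H" for f
    using G.hnorm_triangle_diff[OF mem[OF that]] C[OF that] D[OF that] by (simp add: distrib_right)
  then have "\<exists>B. \<forall>f\<in>vecs H. hnorm G (S f - T f) \<le> B * hnorm H f"
    by blast
  moreover have "S (f + g) - T (f + g) = (S f - T f) + (S g - T g)" if "f \<in> vecs H" "g \<in> vecs H" for f g
    using S T that by (simp add: bounded_ops_def)
  moreover have "S (c *\<^sub>C f) - T (c *\<^sub>C f) = c *\<^sub>C (S f - T f)" if "f \<in> vecs H" for c f
    using S T that by (simp add: bounded_ops_def complex_vector.scale_right_diff_distrib)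
  ultimately show ?thesis
    using mem by (simp add: bounded_ops_def)
qed

lemma id_bounded_ops: "(\<lambda>f. f) \<in> bounded_ops H H"
  by (auto simp: bounded_ops_def intro: exI[of _ 1])

section \<open>Reproducing kernels\<close>

abbreviation kernel_sum :: "('w \<Rightarrow> 'w \<Rightarrow> complex) \<Rightarrow> 'w list \<Rightarrow> 'w \<Rightarrow> complex"
  where "kernel_sum k xs \<equiv> (\<Sum>x\<leftarrow>xs. kernel_section k x)"

context rkhs
begin

lemma kernel_sum_mem: "kernel_sum k xs \<in> vecs R"
  by (intro sum_list_mem section_mem)

lemma ip_section_right: "f \<in> vecs R \<Longrightarrow> ip R f (kernel_section k x) = cnj (f x)"
  using ip_commute[of "kernel_section k x" f] by (simp add: section_mem reproducing)

lemma kernel_commute: "k y x = cnj (k x y)"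
  using ip_section_right[OF section_mem, of y x] ip_sections[of y x]
  by (simp add: kernel_section_def)

lemma ip_kernel_sums: "ip R (kernel_sum k xs) (kernel_sum k ys) = (\<Sum>x\<leftarrow>xs. \<Sum>y\<leftarrow>ys. k x y)"
  by (subst ip_sum_list_left) (simp_all add: ip_sum_list_right section_mem kernel_sum_mem ip_sections)

text \<open>The quadratic form of a bounded operator is continuous and the sections span a dense
  subspace. Operator inequalities therefore have to be checked on combinations of sections
  only.\<close>

lemma bounded_op_nonneg_closure:
  assumes T: "T \<in> bounded_ops R R"
    and pos: "\<And>g. g \<in> complex_vector.span (range (kernel_section k)) \<Longrightarrow> 0 \<le> ip R g (T g)"
    and f: "f \<in> vecs R"
  shows "0 \<le> ip R f (T f)"
proof -
  have span: "g \<in> vecs R" if "g \<in> complex_vector.span (range (kernel_section k))" for g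
    using that complex_vector.span_minimal[OF _ subspace] section_mem by blast
  have "\<exists>g\<in>complex_vector.span (range (kernel_section k)). hnorm R (f - g) < inverse (real (Suc n))" for n
    by (rule dense_span[OF f]) simp
  then obtain \<sigma> where \<sigma>: "\<And>n. \<sigma> n \<in> complex_vector.span (range (kernel_section k))"
    and d: "\<And>n. hnorm R (f - \<sigma> n) < inverse (real (Suc n))"
    by metis
  note mem = span[OF \<sigma>]
  have hnorm_commute: "hnorm R (\<sigma> n - f) = hnorm R (f - \<sigma> n)" for n
    using hnorm_scale[of "f - \<sigma> n" "-1"] mem[of n] f
    by (simp add: complex_vector.scale_minus_left)
  have lim: "(\<lambda>n. hnorm R (\<sigma> n - f)) \<longlonglongrightarrow> 0"
  proof (rule tendsto_sandwich[OF _ _ tendsto_const LIMSEQ_inverse_real_of_nat])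
    show "\<forall>\<^sub>F n in sequentially. 0 \<le> hnorm R (\<sigma> n - f)"
      using mem f by (intro always_eventually) simp
    show "\<forall>\<^sub>F n in sequentially. hnorm R (\<sigma> n - f) \<le> inverse (real (Suc n))"
      using d by (intro always_eventually) (simp add: hnorm_commute less_imp_le)
  qed
  obtain C where C: "\<And>f. f \<in> vecs R \<Longrightarrow> hnorm R (T f) \<le> C * hnorm R f"
    using bounded_ops_bound[OF T] by metis
  have T_mem: "T g \<in> vecs R" if "g \<in> vecs R" for g
    using T that by (simp add: bounded_ops_def)
  \<comment> \<open>Additivity is given for sums of carrier vectors, so the difference is rewritten
    as a sum first.\<close>
  have T_diff: "T (\<sigma> n) - T f = T (\<sigma> n - f)" for n
  proof -
    have "T (\<sigma> n) = T ((\<sigma> n - f) + f)"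
      by simp
    also have "\<dots> = T (\<sigma> n - f) + T f"
      using T mem[of n] f diff_mem[OF mem f] unfolding bounded_ops_def by blast
    finally show ?thesis
      by (simp only: add_diff_cancel_right')
  qed
  have limT: "(\<lambda>n. hnorm R (T (\<sigma> n) - T f)) \<longlonglongrightarrow> 0"
  proof (rule tendsto_sandwich[OF _ _ tendsto_const tendsto_mult_right_zero[OF lim, of C]])
    show "\<forall>\<^sub>F n in sequentially. 0 \<le> hnorm R (T (\<sigma> n) - T f)"
      using mem f by (intro always_eventually) (simp add: T_mem)
    show "\<forall>\<^sub>F n in sequentially. hnorm R (T (\<sigma> n) - T f) \<le> C * hnorm R (\<sigma> n - f)"
      using C mem f by (intro always_eventually) (simp add: T_diff)
  qed
  show ?thesis
    by (rule LIMSEQ_complex_nonneg[OF ip_tendsto[OF mem f lim T_mem[OF mem] T_mem[OF f] limT] pos[OF \<sigma>]])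
qed

end

section \<open>Generalized positive definite kernels and their scalar kernels\<close>

lemma scalar_kernel_apply: "scalar_kernel K (s, a, u) (t, b, v) = cinner u (K s t (star a * b) v)"
  by (simp add: scalar_kernel_def)

text \<open>Three indexed families amount to one list of triples. With lists, adding two sums of
  sections is concatenation, and the double sums are squared norms of sums of sections.\<close>

lemma gpd_kernels_iff:
  "K \<in> gpd_kernels \<longleftrightarrow> (\<forall>s t. K s t \<in> bounded_maps_into_ops) \<and>
    (\<forall>xs. 0 \<le> (\<Sum>x\<leftarrow>xs. \<Sum>y\<leftarrow>xs. scalar_kernel K x y))"
proof -
  have "(\<forall>(N::nat) u s a. 0 \<le> (\<Sum>i<N. \<Sum>j<N. cinner (u i) (K (s i) (s j) (star (a i) * a j) (u j))))
    \<longleftrightarrow> (\<forall>xs. 0 \<le> (\<Sum>x\<leftarrow>xs. \<Sum>y\<leftarrow>xs. scalar_kernel K x y))" (is "?l \<longleftrightarrow> ?r")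
  proof
    assume l: ?l
    show ?r
    proof
      fix xs :: "('a \<times> 'b \<times> 'c) list"
      have "0 \<le> (\<Sum>i<length xs. \<Sum>j<length xs. scalar_kernel K (xs ! i) (xs ! j))"
        using l[rule_format, where N = "length xs" and u = "\<lambda>i. snd (snd (xs ! i))"
          and s = "\<lambda>i. fst (xs ! i)" and a = "\<lambda>i. fst (snd (xs ! i))"]
        by (simp add: scalar_kernel_def split_beta)
      then show "0 \<le> (\<Sum>x\<leftarrow>xs. \<Sum>y\<leftarrow>xs. scalar_kernel K x y)"
        by (simp add: sum_list_sum_nth atLeast0LessThan)
    qed
  next
    assume r: ?r
    show ?l
    proof (intro allI)
      fix N :: nat and u :: "nat \<Rightarrow> 'c" and s :: "nat \<Rightarrow> 'a" and a :: "nat \<Rightarrow> 'b"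
      show "0 \<le> (\<Sum>i<N. \<Sum>j<N. cinner (u i) (K (s i) (s j) (star (a i) * a j) (u j)))"
        using r[rule_format, of "map (\<lambda>i. (s i, a i, u i)) [0..<N]"]
        by (simp add: comp_def interv_sum_list_conv_sum_set_nat scalar_kernel_apply atLeast0LessThan)
    qed
  qed
  then show ?thesis
    unfolding gpd_kernels_def by simp
qed

lemma gpd_kernels_nonneg:
  "K \<in> gpd_kernels \<Longrightarrow> 0 \<le> (\<Sum>x\<leftarrow>xs. \<Sum>y\<leftarrow>xs. scalar_kernel K x y)"
  by (simp add: gpd_kernels_iff)

lemma gpd_kernels_add: "K \<in> gpd_kernels \<Longrightarrow> K s t a (u + v) = K s t a u + K s t a v"
  by (simp add: gpd_kernels_def bounded_maps_into_ops_def bounded_ops_def)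

lemma gpd_kernels_scale: "K \<in> gpd_kernels \<Longrightarrow> K s t a (c *\<^sub>C u) = c *\<^sub>C K s t a u"
  by (simp add: gpd_kernels_def bounded_maps_into_ops_def bounded_ops_def)

lemma kernel_section_add:
  assumes "K \<in> gpd_kernels"
  shows "kernel_section (scalar_kernel K) (t, b, u + v)
    = kernel_section (scalar_kernel K) (t, b, u) + kernel_section (scalar_kernel K) (t, b, v)"
  using gpd_kernels_add[OF assms]
  by (auto simp: kernel_section_def fun_eq_iff scalar_kernel_apply cinner_add_right)

lemma kernel_section_scale:
  assumes "K \<in> gpd_kernels"
  shows "kernel_section (scalar_kernel K) (t, b, c *\<^sub>C v) = c *\<^sub>C kernel_section (scalar_kernel K) (t, b, v)"
  using gpd_kernels_scale[OF assms]
  by (auto simp: kernel_section_def fun_eq_iff scalar_kernel_apply cinner_scaleC_right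
      scaleC_fun_def scaleC_complex_def)

abbreviation scale_point :: "complex \<Rightarrow> 'x \<times> 'a \<times> 'h::chilbert \<Rightarrow> 'x \<times> 'a \<times> 'h"
  where "scale_point c \<equiv> (\<lambda>(t, b, v). (t, b, c *\<^sub>C v))"

lemma kernel_section_scale_point:
  assumes "K \<in> gpd_kernels"
  shows "kernel_section (scalar_kernel K) (scale_point c x) = c *\<^sub>C kernel_section (scalar_kernel K) x"
  by (cases x) (simp add: kernel_section_scale[OF assms])

lemma kernel_sum_scale:
  assumes "K \<in> gpd_kernels"
  shows "kernel_sum (scalar_kernel K) (map (scale_point c) xs) = c *\<^sub>C kernel_sum (scalar_kernel K) xs"
  by (induction xs) (simp_all only: list.map sum_list.Nil sum_list.Cons
      kernel_section_scale_point[OF assms] scaleC_add_right complex_vector.scale_zero_right)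

text \<open>No coefficients are needed, because they can be moved into the vector component of the points.\<close>

lemma span_kernel_sections:
  assumes K: "K \<in> gpd_kernels"
    and "f \<in> complex_vector.span (range (kernel_section (scalar_kernel K)))"
  obtains xs where "f = kernel_sum (scalar_kernel K) xs"
proof -
  have "\<exists>xs. f = kernel_sum (scalar_kernel K) xs"
    using assms(2)
  proof (induction rule: complex_vector.span_induct_alt)
    case base
    show ?case
      by (rule exI[of _ "[]"]) simp
  next
    case (step c g f)
    then obtain x xs where "g = kernel_section (scalar_kernel K) x" "f = kernel_sum (scalar_kernel K) xs"
      by blast
    then have "c *\<^sub>C g + f = kernel_sum (scalar_kernel K) (scale_point c x # xs)"
      by (simp only: list.map sum_list.Cons kernel_section_scale_point[OF K])
    then show ?case ..
  qed
  with that show thesis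
    by blast
qed

lemma scalar_kernel_diff: "scalar_kernel (L - K) x y = scalar_kernel L x y - scalar_kernel K x y"
proof -
  obtain s a u t b v where xy: "x = (s, a, u)" "y = (t, b, v)"
    by (cases x, cases y)
  show ?thesis
    using complex_hilbert_space.ip_diff_right[OF complex_hilbert_space_whole_space]
    by (simp add: xy scalar_kernel_apply)
qed

lemma bounded_maps_into_ops_diff:
  assumes "\<Phi> \<in> bounded_maps_into_ops" "\<Psi> \<in> bounded_maps_into_ops"
  shows "\<Phi> - \<Psi> \<in> bounded_maps_into_ops"
proof -
  obtain C D where C: "\<And>a u. norm (\<Phi> a u) \<le> C * norm a * norm u"
    and D: "\<And>a u. norm (\<Psi> a u) \<le> D * norm a * norm u"
    using assms by (auto simp: bounded_maps_into_ops_def)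
  have "norm ((\<Phi> - \<Psi>) a u) \<le> (C + D) * norm a * norm u" for a u
    using norm_triangle_ineq4[of "\<Phi> a u" "\<Psi> a u"] C[of a u] D[of a u] by (simp add: distrib_right)
  moreover have "(\<Phi> - \<Psi>) a \<in> bounded_ops whole_space whole_space" for a
  proof -
    have "(\<Phi> - \<Psi>) a = (\<lambda>u. \<Phi> a u - \<Psi> a u)"
      by (simp add: fun_eq_iff)
    then show ?thesis
      using assms by (simp add: bounded_ops_diff complex_hilbert_space_whole_space bounded_maps_into_ops_def)
  qed
  ultimately show ?thesis
    using assms
    by (auto simp: bounded_maps_into_ops_def complex_vector.scale_right_diff_distrib)
qed

text \<open>Boundedness of the values of \<open>L - K\<close> is automatic, so only the positivity
  condition remains, and it is linear in the kernel.\<close>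

lemma kernel_le_iff:
  assumes "K \<in> gpd_kernels" "L \<in> gpd_kernels"
  shows "kernel_le K L \<longleftrightarrow>
    (\<forall>xs. (\<Sum>x\<leftarrow>xs. \<Sum>y\<leftarrow>xs. scalar_kernel K x y) \<le> (\<Sum>x\<leftarrow>xs. \<Sum>y\<leftarrow>xs. scalar_kernel L x y))"
proof -
  have "(L - K) s t \<in> bounded_maps_into_ops" for s t
    using assms by (simp add: gpd_kernels_def bounded_maps_into_ops_diff)
  then show ?thesis
    by (simp only: kernel_le_def gpd_kernels_iff scalar_kernel_diff sum_list_subtractf diff_ge_0_iff_ge)
       blast
qed

section \<open>The canonical factorization: action of the representation and adjoint of
  \<open>V\<close>\<close>

context canonical_factorization
begin

lemma rep_mem: "f \<in> vecs R \<Longrightarrow> \<pi> a f \<in> vecs R"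
  using rep by (simp add: star_representation_def bounded_ops_def)

lemma rep_star: "f \<in> vecs R \<Longrightarrow> g \<in> vecs R \<Longrightarrow> ip R f (\<pi> a g) = ip R (\<pi> (star a) f) g"
  using rep star_star[of a] unfolding star_representation_def by metis

lemma rep_mult: "f \<in> vecs R \<Longrightarrow> \<pi> (a * b) f = \<pi> a (\<pi> b f)"
  using rep by (simp add: star_representation_def)

text \<open>Evaluation at a point is the inner product with its section, and moving
  \<open>\<pi> a\<close> across replaces that section by the one at
  \<open>(t, star a * b, v)\<close>. This describes the representation on every function of the
  carrier, including sections of a different kernel that lie in it.\<close>

lemma rep_apply: "f \<in> vecs R \<Longrightarrow> \<pi> a f (t, b, v) = f (t, star a * b, v)"
  using reproducing[of "\<pi> a f" "(t, b, v)"]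
  by (simp add: rep_mem rep_star section_mem rep_section reproducing)

lemma V_mem: "V t v \<in> vecs R"
  by (simp add: V_eq section_mem)

lemma rep_V: "\<pi> a (V t v) = kernel_section (scalar_kernel K) (t, a, v)"
  by (simp add: V_eq rep_section)

lemma ip_V_right: "f \<in> vecs R \<Longrightarrow> ip R (V t v) f = f (t, 1, v)"
  by (simp add: V_eq reproducing)

text \<open>The squared norm of \<open>V t v\<close> is \<open>cinner v (K t t 1 v)\<close>, and
  \<open>K t t 1\<close> is bounded.\<close>

lemma V_bounded:
  assumes K: "K \<in> gpd_kernels"
  obtains C where "\<And>v. hnorm R (V t v) \<le> C * norm v"
proof -
  interpret W: complex_hilbert_space "whole_space :: 'h ips"
    by (rule complex_hilbert_space_whole_space)
  have "K t t 1 \<in> bounded_ops whole_space whole_space"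
    using K by (simp add: gpd_kernels_def bounded_maps_into_ops_def)
  then obtain C where C: "norm (K t t 1 v) \<le> C * norm v" for v
    unfolding bounded_ops_def by (auto simp: hnorm_whole_space)
  \<comment> \<open>The constant \<open>C\<close> may be negative, hence the absolute value under
    the root.\<close>
  have "hnorm R (V t v) \<le> sqrt \<bar>C\<bar> * norm v" for v
  proof (rule power2_le_imp_le)
    have "(hnorm R (V t v))\<^sup>2 = Re (cinner v (K t t 1 v))"
      by (simp add: hnorm_sq V_mem) (simp add: V_eq ip_sections scalar_kernel_apply star_one)
    also have "\<dots> \<le> norm v * norm (K t t 1 v)"
      using W.Cauchy_Schwarz[of v "K t t 1 v"] complex_Re_le_cmod[of "cinner v (K t t 1 v)"]
      by (simp add: hnorm_whole_space)
    also have "\<dots> \<le> norm v * (C * norm v)"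
      by (intro mult_left_mono C) simp
    also have "\<dots> \<le> norm v * (\<bar>C\<bar> * norm v)"
      by (intro mult_left_mono mult_right_mono) simp_all
    finally show "(hnorm R (V t v))\<^sup>2 \<le> (sqrt \<bar>C\<bar> * norm v)\<^sup>2"
      by (simp add: power_mult_distrib power2_eq_square mult_ac)
  qed simp
  with that show thesis
    by blast
qed

text \<open>As \<open>adjoint_op\<close> is a definite description, its defining property is
  available only after existence and uniqueness are shown. Existence is Riesz representation, with
  the bound coming from \<open>V_bounded\<close>.\<close>

lemma adjoint_V:
  assumes K: "K \<in> gpd_kernels" and g: "g \<in> vecs R"
  shows "cinner u (adjoint_op whole_space R (V s) g) = ip R (V s u) g"
proof -
  interpret W: complex_hilbert_space "whole_space :: 'h ips"
    by (rule complex_hilbert_space_whole_space)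
  obtain C where C: "\<And>v. hnorm R (V s v) \<le> C * norm v"
    using V_bounded[OF K] by metis
  \<comment> \<open>The graph of the functional that the adjoint vector has to represent, here
    defined on the whole space.\<close>
  define G where "G = range (\<lambda>u. (u, ip R g (V s u)))"
  obtain f where f: "\<And>u z. (u, z) \<in> G \<Longrightarrow> cinner f u = z"
  proof (rule W.Riesz_linear_relation[of G "hnorm R g * C"])
    show "(0, 0) \<in> G"
      \<comment> \<open>Homogeneity with scalar 0 shows that \<open>V s 0\<close> vanishes.\<close>
      using kernel_section_scale[OF K, of s 1 0 0] g
      by (auto simp: G_def V_eq image_iff intro!: exI[of _ 0])
  next
    fix u z w y
    assume "(u, z) \<in> G" "(w, y) \<in> G"
    then show "(u + w, z + y) \<in> G"
      by (auto simp: G_def V_eq image_iff kernel_section_add[OF K] ip_add_right section_mem g)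
  next
    fix c u z
    assume "(u, z) \<in> G"
    then show "(c *\<^sub>C u, c * z) \<in> G"
      by (auto simp: G_def V_eq image_iff kernel_section_scale[OF K] ip_scale_right section_mem g)
  next
    fix u z
    assume "(u, z) \<in> G"
    then have "cmod z \<le> hnorm R g * hnorm R (V s u)"
      using Cauchy_Schwarz[OF g V_mem] by (auto simp: G_def)
    also have "\<dots> \<le> hnorm R g * (C * norm u)"
      by (intro mult_left_mono C) (simp add: g)
    finally show "cmod z \<le> hnorm R g * C * hnorm whole_space u"
      by (simp add: hnorm_whole_space)
  qed auto
  have "cinner f u = ip R g (V s u)" for u
    using f[of u "ip R g (V s u)"] by (simp add: G_def)
  then have f_adj: "cinner u f = ip R (V s u) g" for u
    by (metis cinner_commute ip_commute[OF g V_mem])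
  have "adjoint_op whole_space R (V s) g = f"
    unfolding adjoint_op_def
  proof (rule the_equality)
    fix f'
    assume "f' \<in> vecs whole_space \<and> (\<forall>h\<in>vecs whole_space. ip whole_space h f' = ip R (V s h) g)"
    then show "f' = f"
      by (intro W.ip_right_eqI) (simp_all add: f_adj)
  qed (simp add: f_adj)
  then show ?thesis
    by (simp add: f_adj)
qed

end

section \<open>Comparison of kernels\<close>

locale dominated_kernel =
  K: rkhs "scalar_kernel K" H\<^sub>K + L: canonical_factorization L H\<^sub>L V \<pi>
  for K L :: "'x \<Rightarrow> 'x \<Rightarrow> 'a::cstar_algebra \<Rightarrow> 'h::chilbert \<Rightarrow> 'h"
    and H\<^sub>K H\<^sub>L :: "('x \<times> 'a \<times> 'h \<Rightarrow> complex) ips" and V \<pi> +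
  assumes gpd_K: "K \<in> gpd_kernels" and gpd_L: "L \<in> gpd_kernels" and le: "kernel_le K L"
begin

abbreviation "k\<^sub>K \<equiv> kernel_section (scalar_kernel K)"
abbreviation "k\<^sub>L \<equiv> kernel_section (scalar_kernel L)"
abbreviation "\<Sigma>\<^sub>K \<equiv> kernel_sum (scalar_kernel K)"
abbreviation "\<Sigma>\<^sub>L \<equiv> kernel_sum (scalar_kernel L)"

text \<open>The squared norms are the double sums that \<open>kernel_le\<close> compares. This is
  the contraction from sections of \<open>L\<close> to sections of \<open>K\<close>.\<close>

lemma hnorm_kernel_sum_le: "hnorm H\<^sub>K (\<Sigma>\<^sub>K xs) \<le> hnorm H\<^sub>L (\<Sigma>\<^sub>L xs)"
  using le kernel_le_iff[OF gpd_K gpd_L]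
  by (simp add: hnorm_def K.ip_kernel_sums L.ip_kernel_sums less_eq_complex_def)

text \<open>The function is the image of \<open>f\<close> under the adjoint of the operator \<open>H\<^sub>L \<rightarrow> M\<close>
  that takes each section of \<open>L\<close> to the section of \<open>K\<close> at the same point.\<close>

lemma adjoint_transfer:
  assumes M: "complex_hilbert_space M"
    and mem: "\<And>x. k\<^sub>K x \<in> vecs M"
    and contr: "\<And>xs. hnorm M (\<Sigma>\<^sub>K xs) \<le> hnorm H\<^sub>L (\<Sigma>\<^sub>L xs)"
    and f: "f \<in> vecs M"
  shows "(\<lambda>x. ip M (k\<^sub>K x) f) \<in> vecs H\<^sub>L \<and> hnorm H\<^sub>L (\<lambda>x. ip M (k\<^sub>K x) f) \<le> hnorm M f"
proof -
  interpret M: complex_hilbert_space M by fact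
  have sum_mem: "\<Sigma>\<^sub>K xs \<in> vecs M" for xs
    by (intro M.sum_list_mem mem)
  \<comment> \<open>The functional to be represented is the inner product of \<open>f\<close> with
    the transferred vector. Two lists may give the same sum for \<open>L\<close>; the norm bound
    makes their values agree.\<close>
  define G where "G = range (\<lambda>xs. (\<Sigma>\<^sub>L xs, ip M f (\<Sigma>\<^sub>K xs)))"
  have GI: "(\<Sigma>\<^sub>L xs, ip M f (\<Sigma>\<^sub>K xs)) \<in> G" for xs
    unfolding G_def by (rule rangeI)
  have GE: "\<exists>xs. h = \<Sigma>\<^sub>L xs \<and> z = ip M f (\<Sigma>\<^sub>K xs)" if "(h, z) \<in> G" for h z
    using that unfolding G_def by blast
  obtain g where g: "g \<in> vecs H\<^sub>L" "\<And>h z. (h, z) \<in> G \<Longrightarrow> ip H\<^sub>L g h = z"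
    and norm_g: "hnorm H\<^sub>L g \<le> \<bar>hnorm M f\<bar>"
  proof (rule L.Riesz_linear_relation[of G "hnorm M f"])
    show "(0, 0) \<in> G"
      using GI[of "[]"] by (simp only: list.map sum_list.Nil M.ip_zero_right[OF f])
  next
    fix h z h' z'
    assume "(h, z) \<in> G" "(h', z') \<in> G"
    then obtain xs ys where "h = \<Sigma>\<^sub>L xs" "z = ip M f (\<Sigma>\<^sub>K xs)" "h' = \<Sigma>\<^sub>L ys" "z' = ip M f (\<Sigma>\<^sub>K ys)"
      using GE by meson
    then show "(h + h', z + z') \<in> G"
      using GI[of "xs @ ys"] by (simp only: map_append sum_list_append M.ip_add_right[OF f sum_mem sum_mem])
  next
    fix c h z
    assume "(h, z) \<in> G"
    then obtain xs where "h = \<Sigma>\<^sub>L xs" "z = ip M f (\<Sigma>\<^sub>K xs)"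
      using GE by meson
    then show "(c *\<^sub>C h, c * z) \<in> G"
      using GI[of "map (scale_point c) xs"]
      by (simp only: kernel_sum_scale gpd_K gpd_L M.ip_scale_right[OF f sum_mem])
  next
    fix h z
    assume "(h, z) \<in> G"
    then obtain xs where xs: "h = \<Sigma>\<^sub>L xs" "z = ip M f (\<Sigma>\<^sub>K xs)"
      using GE by meson
    show "h \<in> vecs H\<^sub>L"
      unfolding xs by (rule L.kernel_sum_mem)
    have "cmod z \<le> hnorm M f * hnorm M (\<Sigma>\<^sub>K xs)"
      unfolding xs by (rule M.Cauchy_Schwarz[OF f sum_mem])
    also have "\<dots> \<le> hnorm M f * hnorm H\<^sub>L h"
      unfolding xs by (intro mult_left_mono contr M.hnorm_nonneg f)
    finally show "cmod z \<le> hnorm M f * hnorm H\<^sub>L h" .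
  qed blast
  \<comment> \<open>One-point lists recover the values of \<open>g\<close>, by the reproducing
    property.\<close>
  have "(k\<^sub>L x, ip M f (k\<^sub>K x)) \<in> G" for x
    using GI[of "[x]"] by (simp only: list.map sum_list.Nil sum_list.Cons add_0_right)
  from g(2)[OF this] have "g x = ip M (k\<^sub>K x) f" for x
    using L.ip_section_right[OF g(1), of x] M.ip_commute[OF mem f, of x]
    by (metis complex_cnj_cnj)
  then have "g = (\<lambda>x. ip M (k\<^sub>K x) f)"
    by (rule ext)
  with g norm_g f show ?thesis
    by simp
qed

text \<open>The case \<open>M = H\<^sub>K\<close> of \<open>adjoint_transfer\<close>: by the
  reproducing property of \<open>K\<close>, the transferred function is \<open>f\<close>
  itself.\<close>

lemma rkhs_contractive_subspace:
  assumes f: "f \<in> vecs H\<^sub>K"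
  shows "f \<in> vecs H\<^sub>L \<and> hnorm H\<^sub>L f \<le> hnorm H\<^sub>K f"
  using adjoint_transfer[OF K.complex_hilbert_space_axioms K.section_mem hnorm_kernel_sum_le f]
  by (simp add: K.reproducing f)

lemma section_mem_L: "k\<^sub>K x \<in> vecs H\<^sub>L"
  using rkhs_contractive_subspace K.section_mem by blast

text \<open>The Radon-Nikodym derivative of \<open>K\<close> with respect to \<open>L\<close>. If J
  is the inclusion of \<open>H\<^sub>K\<close> into \<open>H\<^sub>L\<close>, this is J J*: its
  value at \<open>x\<close> is the inner product of \<open>k\<^sub>K x\<close> with J* f in
  \<open>H\<^sub>K\<close>, which equals the one with \<open>f\<close> in
  \<open>H\<^sub>L\<close>.\<close>

definition radon_nikodym :: "('x \<times> 'a \<times> 'h \<Rightarrow> complex) \<Rightarrow> 'x \<times> 'a \<times> 'h \<Rightarrow> complex"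
  where "radon_nikodym f = (\<lambda>x. ip H\<^sub>L (k\<^sub>K x) f)"

text \<open>The case \<open>M = H\<^sub>L\<close> of \<open>adjoint_transfer\<close>, whose
  contraction hypothesis follows by composing the transfer of sections with the inclusion.\<close>

lemma radon_nikodym_contractive:
  "f \<in> vecs H\<^sub>L \<Longrightarrow> radon_nikodym f \<in> vecs H\<^sub>L \<and> hnorm H\<^sub>L (radon_nikodym f) \<le> hnorm H\<^sub>L f"
  unfolding radon_nikodym_def
proof (rule adjoint_transfer[OF L.complex_hilbert_space_axioms section_mem_L])
  show "hnorm H\<^sub>L (\<Sigma>\<^sub>K xs) \<le> hnorm H\<^sub>L (\<Sigma>\<^sub>L xs)" for xs
    using rkhs_contractive_subspace[OF K.kernel_sum_mem[of xs]] hnorm_kernel_sum_le[of xs] by linarith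
qed

lemma radon_nikodym_bounded: "radon_nikodym \<in> bounded_ops H\<^sub>L H\<^sub>L"
proof -
  have "radon_nikodym (f + g) = radon_nikodym f + radon_nikodym g" if "f \<in> vecs H\<^sub>L" "g \<in> vecs H\<^sub>L" for f g
    using that by (simp add: radon_nikodym_def fun_eq_iff L.ip_add_right section_mem_L)
  moreover have "radon_nikodym (c *\<^sub>C f) = c *\<^sub>C radon_nikodym f" if "f \<in> vecs H\<^sub>L" for f c
    using that by (simp add: radon_nikodym_def L.ip_scale_right section_mem_L) (simp add: scaleC_fun_def scaleC_complex_def)
  moreover have "\<forall>f\<in>vecs H\<^sub>L. hnorm H\<^sub>L (radon_nikodym f) \<le> 1 * hnorm H\<^sub>L f"
    using radon_nikodym_contractive by simp
  ultimately show ?thesis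
    using radon_nikodym_contractive unfolding bounded_ops_def by blast
qed

text \<open>The reproducing property of \<open>L\<close> evaluates \<open>k\<^sub>K x\<close> at
  \<open>y\<close>; Hermitian symmetry of the scalar kernel of \<open>K\<close> exchanges the two
  points.\<close>

lemma radon_nikodym_section: "radon_nikodym (k\<^sub>L y) = k\<^sub>K y"
proof
  fix x
  have "radon_nikodym (k\<^sub>L y) x = cnj (k\<^sub>K x y)"
    by (simp add: radon_nikodym_def L.ip_section_right section_mem_L)
  also have "\<dots> = k\<^sub>K y x"
    using K.kernel_commute[of x y] by (simp add: kernel_section_def)
  finally show "radon_nikodym (k\<^sub>L y) x = k\<^sub>K y x" .
qed

lemma radon_nikodym_kernel_sum: "radon_nikodym (\<Sigma>\<^sub>L xs) = \<Sigma>\<^sub>K xs"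
proof (induction xs)
  case Nil
  have "radon_nikodym 0 = 0"
    by (simp add: radon_nikodym_def fun_eq_iff section_mem_L)
  then show ?case
    by (simp only: list.map sum_list.Nil)
next
  case (Cons x xs)
  have "radon_nikodym (k\<^sub>L x + \<Sigma>\<^sub>L xs) = radon_nikodym (k\<^sub>L x) + radon_nikodym (\<Sigma>\<^sub>L xs)"
    using radon_nikodym_bounded L.section_mem L.kernel_sum_mem by (simp only: bounded_ops_def mem_Collect_eq)
  then show ?case
    by (simp only: list.map sum_list.Cons Cons radon_nikodym_section)
qed

lemma ip_radon_nikodym_kernel_sum:
  "ip H\<^sub>L (\<Sigma>\<^sub>L xs) (radon_nikodym (\<Sigma>\<^sub>L xs)) = (\<Sum>x\<leftarrow>xs. \<Sum>y\<leftarrow>xs. scalar_kernel K x y)"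
proof -
  have "ip H\<^sub>L (k\<^sub>L x) (\<Sigma>\<^sub>K ys) = (\<Sum>y\<leftarrow>ys. scalar_kernel K x y)" for x ys
    by (simp add: L.ip_sum_list_right L.section_mem section_mem_L L.reproducing) (simp add: kernel_section_def)
  then show ?thesis
    unfolding radon_nikodym_kernel_sum
    by (subst L.ip_sum_list_left) (simp_all only: L.sum_list_mem section_mem_L L.section_mem)
qed

text \<open>On sums of sections of \<open>L\<close> the quadratic form is the double sum of
  \<open>K\<close>, which is nonnegative; density does the rest.\<close>

lemma radon_nikodym_nonneg: "op_le H\<^sub>L (\<lambda>_. 0) radon_nikodym"
proof -
  have "0 \<le> ip H\<^sub>L f (radon_nikodym f)" if f: "f \<in> vecs H\<^sub>L" for f
  proof (rule L.bounded_op_nonneg_closure[OF radon_nikodym_bounded _ f])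
    fix g
    assume "g \<in> complex_vector.span (range k\<^sub>L)"
    then obtain xs where "g = \<Sigma>\<^sub>L xs"
      by (rule span_kernel_sections[OF gpd_L])
    then show "0 \<le> ip H\<^sub>L g (radon_nikodym g)"
      using gpd_kernels_nonneg[OF gpd_K, of xs] by (simp only: ip_radon_nikodym_kernel_sum)
  qed
  then show ?thesis
    using radon_nikodym_bounded by (simp only: op_le_def positive_op_def diff_zero) blast
qed

text \<open>The same density argument, where the quadratic form is now the double sum of
  \<open>L\<close> minus that of \<open>K\<close>.\<close>

lemma radon_nikodym_le_id: "op_le H\<^sub>L radon_nikodym (\<lambda>f. f)"
proof -
  have bounded: "(\<lambda>f. f - radon_nikodym f) \<in> bounded_ops H\<^sub>L H\<^sub>L"
    by (intro bounded_ops_diff id_bounded_ops radon_nikodym_bounded L.complex_hilbert_space_axioms)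
  have "0 \<le> ip H\<^sub>L f (f - radon_nikodym f)" if f: "f \<in> vecs H\<^sub>L" for f
  proof (rule L.bounded_op_nonneg_closure[OF bounded _ f])
    fix g
    assume "g \<in> complex_vector.span (range k\<^sub>L)"
    then obtain xs where g: "g = \<Sigma>\<^sub>L xs"
      by (rule span_kernel_sections[OF gpd_L])
    have "ip H\<^sub>L g (g - radon_nikodym g) = ip H\<^sub>L g g - ip H\<^sub>L g (radon_nikodym g)"
      using radon_nikodym_contractive L.kernel_sum_mem unfolding g by (intro L.ip_diff_right) blast+
    then show "0 \<le> ip H\<^sub>L g (g - radon_nikodym g)"
      using le kernel_le_iff[OF gpd_K gpd_L] unfolding g
      by (simp only: ip_radon_nikodym_kernel_sum L.ip_kernel_sums diff_ge_0_iff_ge)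
  qed
  then show ?thesis
    using bounded by (simp only: op_le_def positive_op_def) blast
qed

text \<open>The representation belongs to \<open>L\<close>, but by \<open>rep_apply\<close> it acts
  by a substitution in the middle component. Since scalar kernels contain the algebra elements only
  as \<open>star a * b\<close>, it shifts sections of \<open>K\<close> too.\<close>

lemma rep_section_K: "\<pi> d (k\<^sub>K (s, a, u)) = k\<^sub>K (s, d * a, u)"
  by (auto simp: fun_eq_iff L.rep_apply section_mem_L)
    (simp add: kernel_section_def scalar_kernel_apply star_mult star_star mult.assoc)

text \<open>At \<open>(s, a, u)\<close> both sides are the inner product of
  \<open>k\<^sub>K (s, star d * a, u)\<close> with \<open>f\<close>: on one side
  \<open>\<pi> d\<close> moves onto the section, on the other it substitutes into the point.\<close>

lemma radon_nikodym_commutant: "radon_nikodym \<in> commutant H\<^sub>L (range \<pi>)"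
proof -
  have "radon_nikodym (\<pi> d f) (s, a, u) = \<pi> d (radon_nikodym f) (s, a, u)" if "f \<in> vecs H\<^sub>L" for d f s a u
    using that radon_nikodym_contractive[OF that]
    by (simp add: L.rep_apply) (simp add: radon_nikodym_def L.rep_star section_mem_L rep_section_K)
  then show ?thesis
    using radon_nikodym_bounded by (auto simp: commutant_def)
qed

text \<open>Applied to \<open>V t v\<close>, the operators \<open>radon_nikodym\<close> and
  \<open>\<pi> a\<close> produce \<open>k\<^sub>K (t, a, v)\<close>. The adjoint of
  \<open>V s\<close> then evaluates this at the points \<open>(s, 1, h)\<close>.\<close>

lemma radon_nikodym_factorization: "K s t a = adjoint_op whole_space H\<^sub>L (V s) \<circ> \<pi> a \<circ> radon_nikodym \<circ> V t"
proof
  fix v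
  interpret W: complex_hilbert_space "whole_space :: 'h ips"
    by (rule complex_hilbert_space_whole_space)
  have AV: "\<pi> a (radon_nikodym (V t v)) = k\<^sub>K (t, a, v)"
    by (simp add: L.V_eq radon_nikodym_section rep_section_K)
  have "cinner h (K s t a v) = cinner h (adjoint_op whole_space H\<^sub>L (V s) (k\<^sub>K (t, a, v)))" for h
    by (simp add: L.adjoint_V gpd_L section_mem_L L.ip_V_right)
      (simp add: kernel_section_def scalar_kernel_apply star_one)
  then have "K s t a v = adjoint_op whole_space H\<^sub>L (V s) (k\<^sub>K (t, a, v))"
    by (intro W.ip_right_eqI) simp_all
  then show "K s t a v = (adjoint_op whole_space H\<^sub>L (V s) \<circ> \<pi> a \<circ> radon_nikodym \<circ> V t) v"
    by (simp add: AV)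
qed

end

section \<open>From an operator in the commutant back to the order of kernels\<close>

text \<open>The factorization makes the quadratic form of \<open>A\<close> on a sum of sections the
  double sum of \<open>K'\<close>, while that of the identity is the double sum of
  \<open>K\<close>.\<close>

lemma (in canonical_factorization) kernel_le_of_commutant:
  assumes K: "K \<in> gpd_kernels" and K': "K' \<in> gpd_kernels"
    and A: "A \<in> commutant R (range \<pi>)" and le: "op_le R A (\<lambda>f. f)"
    and fact: "\<And>s t a. K' s t a = adjoint_op whole_space R (V s) \<circ> \<pi> a \<circ> A \<circ> V t"
  shows "kernel_le K' K"
  unfolding kernel_le_iff[OF K' K]
proof
  fix xs
  have bounded: "A \<in> bounded_ops R R"
    using A by (simp add: commutant_def)
  then have A_mem: "A f \<in> vecs R" if "f \<in> vecs R" for f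
    using that by (simp add: bounded_ops_def)
  have A_rep: "A (\<pi> a f) = \<pi> a (A f)" if "f \<in> vecs R" for a f
    using A that by (simp add: commutant_def)
  have kernel: "ip R (kernel_section (scalar_kernel K) x) (A (kernel_section (scalar_kernel K) y))
      = scalar_kernel K' x y" for x y
  proof -
    obtain s a u t b v where xy: "x = (s, a, u)" "y = (t, b, v)"
      by (cases x, cases y)
    \<comment> \<open>Each section is \<open>\<pi> a\<close> applied to a value of \<open>V\<close>.
      Commuting \<open>A\<close> past \<open>\<pi> b\<close> and collecting both factors into
      \<open>\<pi> (star a * b)\<close> brings the expression into the form of
      \<open>fact\<close>.\<close>
    have "ip R (kernel_section (scalar_kernel K) x) (A (kernel_section (scalar_kernel K) y))
        = ip R (\<pi> a (V s u)) (\<pi> b (A (V t v)))"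
      by (simp add: xy rep_V[symmetric] A_rep V_mem)
    also have "\<dots> = ip R (V s u) (\<pi> (star a * b) (A (V t v)))"
      by (simp add: rep_mult rep_star[of "V s u" _ "star a"] star_star rep_mem A_mem V_mem)
    also have "\<dots> = scalar_kernel K' x y"
      by (simp add: xy scalar_kernel_apply fact adjoint_V K rep_mem A_mem V_mem)
    finally show ?thesis .
  qed
  define f where "f = kernel_sum (scalar_kernel K) xs"
  have f: "f \<in> vecs R"
    unfolding f_def by (rule kernel_sum_mem)
  have A_sum: "A (kernel_sum (scalar_kernel K) ys) = (\<Sum>y\<leftarrow>ys. A (kernel_section (scalar_kernel K) y))" for ys
  proof (induction ys)
    case Nil
    \<comment> \<open>Homogeneity with scalar 0 gives \<open>A 0 = 0\<close>.\<close>
    have "A (0 *\<^sub>C 0) = 0 *\<^sub>C A 0"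
      using bounded zero_mem unfolding bounded_ops_def by blast
    then show ?case
      by (simp only: list.map sum_list.Nil complex_vector.scale_zero_left)
  next
    case (Cons y ys)
    have "A (kernel_section (scalar_kernel K) y + kernel_sum (scalar_kernel K) ys)
        = A (kernel_section (scalar_kernel K) y) + A (kernel_sum (scalar_kernel K) ys)"
      using bounded section_mem kernel_sum_mem by (simp only: bounded_ops_def mem_Collect_eq)
    then show ?case
      by (simp only: list.map sum_list.Cons Cons)
  qed
  have "ip R f (A f) = (\<Sum>x\<leftarrow>xs. \<Sum>y\<leftarrow>xs. scalar_kernel K' x y)"
    unfolding f_def A_sum
    by (subst ip_sum_list_left) (simp_all only: ip_sum_list_right sum_list_mem section_mem A_mem kernel)
  moreover have "ip R f (f - A f) = ip R f f - ip R f (A f)"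
    by (intro ip_diff_right f A_mem)
  moreover have "0 \<le> ip R f (f - A f)"
    using le f by (simp add: op_le_def positive_op_def)
  moreover have "ip R f f = (\<Sum>x\<leftarrow>xs. \<Sum>y\<leftarrow>xs. scalar_kernel K x y)"
    unfolding f_def by (rule ip_kernel_sums)
  ultimately show "(\<Sum>x\<leftarrow>xs. \<Sum>y\<leftarrow>xs. scalar_kernel K' x y) \<le> (\<Sum>x\<leftarrow>xs. \<Sum>y\<leftarrow>xs. scalar_kernel K x y)"
    by (simp only: diff_ge_0_iff_ge)
qed

theorem theorem4:
  fixes K L :: "'x \<Rightarrow> 'x \<Rightarrow> 'a::cstar_algebra \<Rightarrow> 'h::chilbert \<Rightarrow> 'h"
    and H\<^sub>K H\<^sub>L :: "('x \<times> 'a \<times> 'h \<Rightarrow> complex) ips"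
    and V\<^sub>K V\<^sub>L :: "'x \<Rightarrow> 'h \<Rightarrow> ('x \<times> 'a \<times> 'h \<Rightarrow> complex)"
    and \<pi>\<^sub>K \<pi>\<^sub>L :: "'a \<Rightarrow> ('x \<times> 'a \<times> 'h \<Rightarrow> complex) \<Rightarrow> ('x \<times> 'a \<times> 'h \<Rightarrow> complex)"
  assumes "K \<in> gpd_kernels" and "L \<in> gpd_kernels"
    and "canonical_factorization K H\<^sub>K V\<^sub>K \<pi>\<^sub>K"
    and "canonical_factorization L H\<^sub>L V\<^sub>L \<pi>\<^sub>L"
  shows "kernel_le K L \<longleftrightarrow>
    (\<exists>A \<in> bounded_ops H\<^sub>L H\<^sub>L.
      op_le H\<^sub>L (\<lambda>_. 0) A \<and> op_le H\<^sub>L A (\<lambda>f. f) \<and>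
      A \<in> commutant H\<^sub>L (range \<pi>\<^sub>L) \<and>
      (\<forall>s t a. K s t a = adjoint_op whole_space H\<^sub>L (V\<^sub>L s) \<circ> \<pi>\<^sub>L a \<circ> A \<circ> V\<^sub>L t))"
proof
  assume "kernel_le K L"
  interpret dominated_kernel K L H\<^sub>K H\<^sub>L V\<^sub>L \<pi>\<^sub>L
    using assms \<open>kernel_le K L\<close>
    by (simp add: dominated_kernel_def dominated_kernel_axioms_def canonical_factorization_def)
  show "\<exists>A \<in> bounded_ops H\<^sub>L H\<^sub>L.
      op_le H\<^sub>L (\<lambda>_. 0) A \<and> op_le H\<^sub>L A (\<lambda>f. f) \<and>
      A \<in> commutant H\<^sub>L (range \<pi>\<^sub>L) \<and>
      (\<forall>s t a. K s t a = adjoint_op whole_space H\<^sub>L (V\<^sub>L s) \<circ> \<pi>\<^sub>L a \<circ> A \<circ> V\<^sub>L t)"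
    using radon_nikodym_bounded radon_nikodym_nonneg radon_nikodym_le_id radon_nikodym_commutant
      radon_nikodym_factorization by blast
next
  assume "\<exists>A \<in> bounded_ops H\<^sub>L H\<^sub>L.
      op_le H\<^sub>L (\<lambda>_. 0) A \<and> op_le H\<^sub>L A (\<lambda>f. f) \<and>
      A \<in> commutant H\<^sub>L (range \<pi>\<^sub>L) \<and>
      (\<forall>s t a. K s t a = adjoint_op whole_space H\<^sub>L (V\<^sub>L s) \<circ> \<pi>\<^sub>L a \<circ> A \<circ> V\<^sub>L t)"
  then show "kernel_le K L"
    using canonical_factorization.kernel_le_of_commutant[OF assms(4,2,1)] by blast
qed

end
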